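(* (Reverse convolution inequality) Let $0\le\eta<T_0<\infty$ and $\delta>0$ be arbitrarily given. Suppose that $f_1\in L^1(\eta,T_0+\delta)$, $f_2\in L^1(0,T_0+\delta-\eta)$ and $f_2\ge0$ on $(0,T_0+\delta-\eta)$. (a) If $f_1$ keeps its sign on $(\eta,T_0+\delta)$, then $$\|f_1\|_{L^1(\eta,T_0)}\,\|f_2\|_{L^1(0,\delta)}\le\left\|\int_\eta^tf_1(s)f_2(t-s)\,ds\right\|_{L^1(\eta,T_0+\delta)}.$$ (b) If $f_1$ only keeps its sign on $(\eta,T_0)$, then $$\|f_1\|_{L^1(\eta,T_0)}\,\|f_2\|_{L^1(0,\delta)}\le\left\|\int_\eta^tf_1(s)f_2(t-s)\,ds\right\|_{L^1(\eta,T_0+\delta)}+2\,\|f_1\|_{L^1(T_0,T_0+\delta)}\,\|f_2\|_{L^1(0,\delta)}.$$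
   Context: All functions are real-valued. "$f_1$ keeps its sign on an interval" means that $f_1\ge0$ (a.e.) on the interval or $f_1\le0$ (a.e.) on the interval. The $L^1(\eta,T_0+\delta)$ norm of the integral $\int_\eta^tf_1(s)f_2(t-s)\,ds$ is taken with respect to $t$. *)

theory Defs
  imports "HOL-Analysis.Analysis"
begin

text \<open>Elements of \<open>L\<^sup>1(a, b)\<close> are represented by functions on the whole real line;
  only their values on \<open>(a, b)\<close>, up to Lebesgue null sets, matter below.\<close>

definition in_L1 :: "real \<Rightarrow> real \<Rightarrow> (real \<Rightarrow> real) \<Rightarrow> bool" where
  "in_L1 a b f \<longleftrightarrow> set_integrable lebesgue {a<..<b} f"

definition L1_norm :: "real \<Rightarrow> real \<Rightarrow> (real \<Rightarrow> real) \<Rightarrow> real" where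
  "L1_norm a b f = (LINT t:{a<..<b}|lebesgue. \<bar>f t\<bar>)"

definition nonneg_on :: "real \<Rightarrow> real \<Rightarrow> (real \<Rightarrow> real) \<Rightarrow> bool" where
  "nonneg_on a b f \<longleftrightarrow> (AE t in lebesgue. t \<in> {a<..<b} \<longrightarrow> 0 \<le> f t)"

definition keeps_sign :: "real \<Rightarrow> real \<Rightarrow> (real \<Rightarrow> real) \<Rightarrow> bool" where
  "keeps_sign a b f \<longleftrightarrow> nonneg_on a b f \<or> nonneg_on a b (\<lambda>t. - f t)"

text \<open>The integral \<open>\<integral>\<^bsub>\<eta>\<^esub>\<^bsup>t\<^esup> f\<^sub>1(s) f\<^sub>2(t - s) ds\<close>. For integrable \<open>f\<^sub>1\<close>, \<open>f\<^sub>2\<close> the integrand is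
  integrable for almost every \<open>t\<close>; at the exceptional \<open>t\<close> the Bochner integral is \<open>0\<close>, which
  does not affect \<open>L\<^sup>1\<close> norms in \<open>t\<close>.\<close>

definition conv_from :: "real \<Rightarrow> (real \<Rightarrow> real) \<Rightarrow> (real \<Rightarrow> real) \<Rightarrow> real \<Rightarrow> real" where
  "conv_from \<eta> f1 f2 t = (LINT s:{\<eta><..<t}|lebesgue. f1 s * f2 (t - s))"

end

theory Submission
  imports Defs
begin

text \<open>By Tonelli, for \<open>f\<^sub>1, f\<^sub>2 \<ge> 0\<close> the norm of the convolution is the integral over \<open>s\<close> of
  \<open>f\<^sub>1(s)\<close> times the integral of \<open>f\<^sub>2\<close> over \<open>(0, T\<^sub>0 + \<delta> - s)\<close>, and that interval contains
  \<open>(0, \<delta>)\<close> as soon as \<open>s < T\<^sub>0\<close>; this is (a).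
  For (b), apply (a) to the part of \<open>f\<^sub>1\<close> living on \<open>(\<eta>, T\<^sub>0)\<close>. The part living
  on \<open>(T\<^sub>0, T\<^sub>0 + \<delta>)\<close> only sees \<open>f\<^sub>2\<close> on \<open>(0, \<delta>)\<close>, so its convolution has norm at most
  the product of the norms (which gives (b) even with constant 1 instead of 2).
  To have Fubini available, \<open>f\<^sub>1\<close> and \<open>f\<^sub>2\<close> are first replaced by Borel functions on the
  whole line that vanish outside the given intervals.\<close>

section \<open>Convolution on the whole line and Fubini's theorem\<close>

definition conv :: "(real \<Rightarrow> real) \<Rightarrow> (real \<Rightarrow> real) \<Rightarrow> real \<Rightarrow> real" where
  "conv F G t = (LINT s|lborel. F s * G (t - s))"

lemma integrable_translate:
  fixes G :: "real \<Rightarrow> real"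
  assumes "integrable lborel G"
  shows "integrable lborel (\<lambda>t. G (t - s))"
  using lborel_integrable_real_affine[OF assms, of 1 "- s"] by simp

text \<open>By translation invariance the integral of \<open>\<bar>F s * G (t - s)\<bar>\<close>
  over \<open>t\<close> is \<open>\<bar>F s\<bar>\<close> times the norm of \<open>G\<close>, which
  is integrable in \<open>s\<close>. The factor \<open>indicator S t\<close> is carried along so
  that Fubini applies directly to integrals over \<open>t\<close> in \<open>S\<close>.\<close>

lemma integrable_conv_kernel:
  fixes F G :: "real \<Rightarrow> real"
  assumes F: "integrable lborel F" and G: "integrable lborel G" and S: "S \<in> sets borel"
  shows "integrable (lborel \<Otimes>\<^sub>M lborel) (\<lambda>(s, t). indicator S t * (F s * G (t - s)))"
proof -
  have [measurable]: "F \<in> borel_measurable borel" "G \<in> borel_measurable borel" "S \<in> sets borel"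
    using borel_measurable_integrable[OF F] borel_measurable_integrable[OF G] S by auto
  have "integrable (lborel \<Otimes>\<^sub>M lborel) (\<lambda>(s, t). F s * G (t - s))"
  proof (rule lborel_pair.Fubini_integrable)
    have "(LINT t|lborel. \<bar>G (t - s)\<bar>) = (LINT t|lborel. \<bar>G t\<bar>)" for s
      using lborel_integral_real_affine[of 1 "\<lambda>t. \<bar>G t\<bar>" "- s"] by (simp add: algebra_simps)
    then show "integrable lborel (\<lambda>s. LINT t|lborel. norm (case (s, t) of (s, t) \<Rightarrow> F s * G (t - s)))"
      using F by (simp add: abs_mult)
    show "AE s in lborel. integrable lborel (\<lambda>t. case (s, t) of (s, t) \<Rightarrow> F s * G (t - s))"
      using integrable_translate[OF G] by simp
  qed measurable
  then show ?thesis
    by (rule Bochner_Integration.integrable_bound) (auto split: split_indicator)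
qed

lemma integrable_conv:
  assumes "integrable lborel F" and "integrable lborel G" and "S \<in> sets borel"
  shows "integrable lborel (\<lambda>t. indicator S t * conv F G t)"
  using lborel_pair.integrable_snd[OF integrable_conv_kernel[OF assms]]
  by (simp add: conv_def)

text \<open>Fubini, then the substitution \<open>t = u + s\<close>, which moves the restriction on
  \<open>t\<close> to the argument \<open>u + s\<close>. For an interval \<open>S\<close>, the inner
  integral is then that of \<open>G\<close> over the interval shifted by \<open>- s\<close>, ready
  to be compared with \<open>(0, d)\<close>.\<close>

lemma integral_conv:
  assumes "integrable lborel F" and "integrable lborel G" and "S \<in> sets borel"
  shows "(LINT t|lborel. indicator S t * conv F G t) =
      (LINT s|lborel. F s * (LINT u|lborel. indicator S (u + s) * G u))"
proof -
  have "(LINT t|lborel. indicator S t * conv F G t) =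
      (LINT s|lborel. LINT t|lborel. indicator S t * (F s * G (t - s)))"
    using lborel_pair.Fubini_integral[OF integrable_conv_kernel[OF assms]]
    by (simp add: conv_def)
  also have "\<dots> = (LINT s|lborel. F s * (LINT t|lborel. indicator S t * G (t - s)))"
    by (simp add: mult.left_commute)
  also have "(\<lambda>s. LINT t|lborel. indicator S t * G (t - s)) =
      (\<lambda>s. LINT u|lborel. indicator S (u + s) * G u)"
  proof
    fix s
    show "(LINT t|lborel. indicator S t * G (t - s)) =
        (LINT u|lborel. indicator S (u + s) * G u)"
      using lborel_integral_real_affine[of 1 "\<lambda>t. indicator S t * G (t - s)" s]
      by (simp add: algebra_simps)
  qed
  finally show ?thesis .
qed

text \<open>Fubini also makes the outer integrand of \<open>integral_conv\<close> integrable, as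
  required when such integrals are compared by \<open>integral_mono\<close>.\<close>

lemma integrable_outer_conv:
  fixes F G :: "real \<Rightarrow> real"
  assumes "integrable lborel F" and "integrable lborel G" and "S \<in> sets borel"
  shows "integrable lborel (\<lambda>s. F s * (LINT u|lborel. indicator S (u + s) * G u))"
proof -
  have "integrable lborel (\<lambda>s. LINT t|lborel. indicator S t * (F s * G (t - s)))"
    using lborel_pair.integrable_fst[OF integrable_conv_kernel[OF assms]] by simp
  moreover have "(LINT t|lborel. indicator S t * (F s * G (t - s))) =
      F s * (LINT u|lborel. indicator S (u + s) * G u)" for s
    using lborel_integral_real_affine[of 1 "\<lambda>t. indicator S t * G (t - s)" s]
    by (simp add: algebra_simps)
  ultimately show ?thesis by simp
qed

section \<open>Lower and upper bounds for convolutions of nonnegative functions\<close>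

lemma integrable_indicator_mult:
  fixes F :: "real \<Rightarrow> real"
  assumes "integrable lborel F" and "S \<in> sets borel"
  shows "integrable lborel (\<lambda>t. indicator S t * F t)"
  using integrable_mult_indicator[of S lborel F] assms by simp

lemma integrable_indicator_shift_mult:
  fixes F :: "real \<Rightarrow> real"
  assumes "integrable lborel F" and [measurable]: "S \<in> sets borel"
  shows "integrable lborel (\<lambda>t. indicator S (t + s) * F t)"
  using assms(1) borel_measurable_integrable[OF assms(1)]
  by (intro Bochner_Integration.integrable_bound[OF assms(1)]) (auto split: split_indicator)

text \<open>If \<open>s\<close> is in \<open>(a, b)\<close> and \<open>u\<close> in
  \<open>(0, d)\<close>, then \<open>u + s\<close> is in \<open>(a, b + d)\<close>, so the inner
  integral in \<open>integral_conv\<close> is at least the integral of \<open>G\<close> over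
  \<open>(0, d)\<close>. For all other \<open>s\<close> the integrand on the left is 0 and the one
  on the right is nonnegative.\<close>

lemma reverse_convolution_nonneg:
  fixes F G :: "real \<Rightarrow> real"
  assumes F: "integrable lborel F" "\<And>s. 0 \<le> F s" "\<And>s. s \<le> a \<Longrightarrow> F s = 0"
    and G: "integrable lborel G" "\<And>s. 0 \<le> G s"
  shows "(LINT s|lborel. indicator {a<..<b} s * F s) * (LINT u|lborel. indicator {0<..<d} u * G u)
      \<le> (LINT t|lborel. indicator {a<..<b + d} t * conv F G t)"
proof -
  have "(LINT s|lborel. indicator {a<..<b} s * F s) * (LINT u|lborel. indicator {0<..<d} u * G u)
      = (LINT s|lborel. indicator {a<..<b} s * F s * (LINT u|lborel. indicator {0<..<d} u * G u))"
    by simp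
  also have "\<dots> \<le> (LINT s|lborel. F s * (LINT u|lborel. indicator {a<..<b + d} (u + s) * G u))"
  proof (rule integral_mono)
    fix s
    have "(LINT u|lborel. indicator {0<..<d} u * G u)
        \<le> (LINT u|lborel. indicator {a<..<b + d} (u + s) * G u)" if "s \<in> {a<..<b}"
      using that G
      by (intro integral_mono integrable_indicator_mult integrable_indicator_shift_mult)
        (auto split: split_indicator)
    moreover have "0 \<le> (LINT u|lborel. indicator {a<..<b + d} (u + s) * G u)"
      using G by (intro integral_nonneg_AE) auto
    ultimately show "indicator {a<..<b} s * F s * (LINT u|lborel. indicator {0<..<d} u * G u)
        \<le> F s * (LINT u|lborel. indicator {a<..<b + d} (u + s) * G u)"
      using F by (auto split: split_indicator intro: mult_left_mono)
  qed (use F G in \<open>auto intro!: integrable_outer_conv integrable_indicator_mult\<close>)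
  finally show ?thesis
    using integral_conv[OF F(1) G(1), of "{a<..<b + d}"] by simp
qed

text \<open>Only \<open>s > b\<close> and \<open>u > 0\<close> contribute, and then
  \<open>u + s < b + d\<close> forces \<open>u < d\<close>. So the inner integral in
  \<open>integral_conv\<close> is at most the integral of \<open>G\<close> over
  \<open>(0, d)\<close>.\<close>

lemma convolution_bound_right:
  fixes F G :: "real \<Rightarrow> real"
  assumes F: "integrable lborel F" "\<And>s. 0 \<le> F s" "\<And>s. s \<le> b \<Longrightarrow> F s = 0"
    and G: "integrable lborel G" "\<And>s. 0 \<le> G s" "\<And>s. s \<le> 0 \<Longrightarrow> G s = 0"
  shows "(LINT t|lborel. indicator {a<..<b + d} t * conv F G t)
      \<le> (LINT s|lborel. F s) * (LINT u|lborel. indicator {0<..<d} u * G u)"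
proof -
  have "(LINT t|lborel. indicator {a<..<b + d} t * conv F G t)
      = (LINT s|lborel. F s * (LINT u|lborel. indicator {a<..<b + d} (u + s) * G u))"
    using integral_conv[OF F(1) G(1), of "{a<..<b + d}"] by simp
  also have "\<dots> \<le> (LINT s|lborel. F s * (LINT u|lborel. indicator {0<..<d} u * G u))"
  proof (rule integral_mono)
    fix s
    have "(LINT u|lborel. indicator {a<..<b + d} (u + s) * G u)
        \<le> (LINT u|lborel. indicator {0<..<d} u * G u)" if "b < s"
    proof (intro integral_mono integrable_indicator_mult integrable_indicator_shift_mult)
      fix u
      show "indicator {a<..<b + d} (u + s) * G u \<le> indicator {0<..<d} u * G u"
        using that G(2)[of u] G(3)[of u] by (cases "u \<le> 0") (auto split: split_indicator)
    qed (use G in auto)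
    then show "F s * (LINT u|lborel. indicator {a<..<b + d} (u + s) * G u)
        \<le> F s * (LINT u|lborel. indicator {0<..<d} u * G u)"
      using F by (cases "s \<le> b") (auto intro: mult_left_mono)
  qed (use F G in \<open>auto intro!: integrable_outer_conv\<close>)
  finally show ?thesis by simp
qed

section \<open>Signs, absolute values and additivity of the convolution\<close>

lemma conv_cong_AE:
  assumes "integrable lborel F" "integrable lborel F'" "integrable lborel G"
    and ae: "AE s in lborel. F s = F' s"
  shows "conv F G t = conv F' G t"
  unfolding conv_def
proof (rule integral_cong_AE)
  have [measurable]: "F \<in> borel_measurable borel" "F' \<in> borel_measurable borel" "G \<in> borel_measurable borel"
    using assms(1-3)[THEN borel_measurable_integrable] by auto
  show "(\<lambda>s. F s * G (t - s)) \<in> borel_measurable lborel" "(\<lambda>s. F' s * G (t - s)) \<in> borel_measurable lborel"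
    by measurable
qed (use ae in auto)

text \<open>\<open>F\<close> agrees a.e. with \<open>\<bar>F\<bar>\<close> or with its negative, and
  \<open>G\<close> is nonnegative, so nothing cancels. This is where the sign condition enters: it
  makes the bounds for nonnegative functions applicable.\<close>

lemma abs_conv_keeps_sign:
  assumes F: "integrable lborel F" and G: "integrable lborel G" "\<And>s. 0 \<le> G s"
    and sign: "(AE s in lborel. 0 \<le> F s) \<or> (AE s in lborel. F s \<le> 0)"
  shows "\<bar>conv F G t\<bar> = conv (\<lambda>s. \<bar>F s\<bar>) G t"
proof -
  have nonneg: "0 \<le> conv (\<lambda>s. \<bar>F s\<bar>) G t"
    unfolding conv_def using G by (intro integral_nonneg_AE) auto
  from sign show ?thesis
  proof
    assume "AE s in lborel. 0 \<le> F s"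
    then have "conv F G t = conv (\<lambda>s. \<bar>F s\<bar>) G t"
      using F G by (intro conv_cong_AE) auto
    with nonneg show ?thesis by simp
  next
    assume "AE s in lborel. F s \<le> 0"
    then have "conv F G t = conv (\<lambda>s. - \<bar>F s\<bar>) G t"
      using F G by (intro conv_cong_AE) auto
    also have "\<dots> = - conv (\<lambda>s. \<bar>F s\<bar>) G t"
      by (simp add: conv_def)
    finally show ?thesis using nonneg by simp
  qed
qed

lemma abs_conv_le:
  assumes "\<And>s. 0 \<le> G s"
  shows "\<bar>conv F G t\<bar> \<le> conv (\<lambda>s. \<bar>F s\<bar>) G t"
  using integral_abs_bound[of lborel "\<lambda>s. F s * G (t - s)"] assms
  by (simp add: conv_def abs_mult)

text \<open>Additivity holds wherever both integrands are integrable in \<open>s\<close>, which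
  Fubini gives for a.e. \<open>t\<close>. At the other \<open>t\<close> a Bochner integral may take
  its default value 0, and additivity can fail.\<close>

lemma AE_conv_add:
  assumes F: "integrable lborel F" and H: "integrable lborel H" and G: "integrable lborel G"
  shows "AE t in lborel. conv (\<lambda>s. F s + H s) G t = conv F G t + conv H G t"
proof -
  have "AE t in lborel. integrable lborel (\<lambda>s. F s * G (t - s))"
    "AE t in lborel. integrable lborel (\<lambda>s. H s * G (t - s))"
    using lborel_pair.AE_integrable_snd[OF integrable_conv_kernel[OF F G, of UNIV]]
      lborel_pair.AE_integrable_snd[OF integrable_conv_kernel[OF H G, of UNIV]] by simp_all
  then show ?thesis
    by eventually_elim (simp add: conv_def distrib_right)
qed

section \<open>Inequality (b) for Borel functions\<close>

lemma integrable_abs_conv: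
  assumes "integrable lborel F" and "integrable lborel G" and "S \<in> sets borel"
  shows "integrable lborel (\<lambda>t. indicator S t * \<bar>conv F G t\<bar>)"
  using integrable_abs[OF integrable_conv[OF assms]] by (simp add: abs_mult)

text \<open>With \<open>F = P + H\<close> cut at \<open>b\<close>, the triangle inequality bounds
  \<open>\<bar>conv P G\<bar>\<close> by \<open>\<bar>conv F G\<bar>\<close> plus the convolution of
  \<open>\<bar>H\<bar>\<close> with \<open>G\<close>. The lower bound applies to \<open>P\<close>,
  the upper bound to \<open>H\<close>.\<close>

lemma reverse_convolution_split:
  fixes F G :: "real \<Rightarrow> real"
  assumes F: "integrable lborel F" "\<And>s. s \<notin> {a<..<b + d} \<Longrightarrow> F s = 0"
    and sign: "(AE s in lborel. s < b \<longrightarrow> 0 \<le> F s) \<or> (AE s in lborel. s < b \<longrightarrow> F s \<le> 0)"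
    and G: "integrable lborel G" "\<And>s. 0 \<le> G s" "\<And>s. s \<le> 0 \<Longrightarrow> G s = 0"
  shows "(LINT s|lborel. indicator {a<..<b} s * \<bar>F s\<bar>) * (LINT u|lborel. indicator {0<..<d} u * G u)
      \<le> (LINT t|lborel. indicator {a<..<b + d} t * \<bar>conv F G t\<bar>)
        + (LINT s|lborel. indicator {b<..<b + d} s * \<bar>F s\<bar>) * (LINT u|lborel. indicator {0<..<d} u * G u)"
proof -
  define P where "P s = indicator {..<b} s * F s" for s
  define H where "H s = indicator {b<..} s * F s" for s
  have P: "integrable lborel P" and H: "integrable lborel H"
    unfolding P_def H_def using F by (auto intro!: integrable_indicator_mult)
  \<comment> \<open>Both parts vanish at \<open>b\<close> itself, hence equality only off a null
    set.\<close>
  have PH: "AE s in lborel. F s = P s + H s"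
    using AE_lborel_singleton[of b]
    by eventually_elim (auto simp: P_def H_def split: split_indicator)
  have conv_PH: "AE t in lborel. conv F G t = conv P G t + conv H G t"
    using AE_conv_add[OF P H G(1)] conv_cong_AE[OF F(1) _ G(1) PH] P H by simp
  \<comment> \<open>As \<open>P\<close> is 0 from \<open>b\<close> on, the sign of \<open>F\<close>
    to the left of \<open>b\<close> is a sign of \<open>P\<close> on the whole line.\<close>
  have "(s < b \<longrightarrow> 0 \<le> F s) = (0 \<le> P s)" "(s < b \<longrightarrow> F s \<le> 0) = (P s \<le> 0)" for s
    by (simp_all add: P_def split: split_indicator)
  with sign have "(AE s in lborel. 0 \<le> P s) \<or> (AE s in lborel. P s \<le> 0)"
    by simp
  then have abs_P: "\<bar>conv P G t\<bar> = conv (\<lambda>s. \<bar>P s\<bar>) G t" for t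
    by (intro abs_conv_keeps_sign P G)
  have "(LINT s|lborel. indicator {a<..<b} s * \<bar>F s\<bar>) * (LINT u|lborel. indicator {0<..<d} u * G u)
      = (LINT s|lborel. indicator {a<..<b} s * \<bar>P s\<bar>) * (LINT u|lborel. indicator {0<..<d} u * G u)"
    by (rule arg_cong2[where f = "(*)"], rule Bochner_Integration.integral_cong)
      (auto simp: P_def split: split_indicator)
  also have "\<dots> \<le> (LINT t|lborel. indicator {a<..<b + d} t * \<bar>conv P G t\<bar>)"
    unfolding abs_P
  proof (rule reverse_convolution_nonneg)
    show "\<bar>P s\<bar> = 0" if "s \<le> a" for s
      using F(2) that by (simp add: P_def)
  qed (use P G in simp_all)
  also have "\<dots> \<le> (LINT t|lborel. indicator {a<..<b + d} t * \<bar>conv F G t\<bar>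
      + indicator {a<..<b + d} t * conv (\<lambda>s. \<bar>H s\<bar>) G t)"
  proof (rule integral_mono_AE)
    show "AE t in lborel. indicator {a<..<b + d} t * \<bar>conv P G t\<bar>
        \<le> indicator {a<..<b + d} t * \<bar>conv F G t\<bar> + indicator {a<..<b + d} t * conv (\<lambda>s. \<bar>H s\<bar>) G t"
      using conv_PH
    proof eventually_elim
      case (elim t)
      then show ?case
        using abs_conv_le[of G H t, OF G(2)] by (auto split: split_indicator)
    qed
  qed (use F(1) P H G(1) in \<open>auto intro!: integrable_abs_conv integrable_conv\<close>)
  also have "\<dots> = (LINT t|lborel. indicator {a<..<b + d} t * \<bar>conv F G t\<bar>)
      + (LINT t|lborel. indicator {a<..<b + d} t * conv (\<lambda>s. \<bar>H s\<bar>) G t)"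
    using F(1) H G(1)
    by (intro Bochner_Integration.integral_add integrable_abs_conv integrable_conv) auto
  also have "(LINT t|lborel. indicator {a<..<b + d} t * conv (\<lambda>s. \<bar>H s\<bar>) G t)
      \<le> (LINT s|lborel. \<bar>H s\<bar>) * (LINT u|lborel. indicator {0<..<d} u * G u)"
  proof (rule convolution_bound_right)
    show "\<bar>H s\<bar> = 0" if "s \<le> b" for s
      using that by (simp add: H_def)
  qed (use H G in simp_all)
  \<comment> \<open>\<open>F\<close> vanishes from \<open>b + d\<close> on, so all the mass of
    \<open>H\<close> lies in \<open>(b, b + d)\<close>.\<close>
  also have "(LINT s|lborel. \<bar>H s\<bar>) = (LINT s|lborel. indicator {b<..<b + d} s * \<bar>F s\<bar>)"
    using F(2) by (intro Bochner_Integration.integral_cong) (auto simp: H_def split: split_indicator)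
  finally show ?thesis by simp
qed

section \<open>Passage from Lebesgue measurable functions to Borel representatives\<close>

lemma integral_lebesgue_eq_lborel:
  fixes f g :: "real \<Rightarrow> real"
  assumes g: "g \<in> borel_measurable lborel" and ae: "AE x in lborel. f x = g x"
  shows "integral\<^sup>L lebesgue f = integral\<^sup>L lborel g"
proof -
  have g': "g \<in> borel_measurable lebesgue"
    using g by (rule measurable_completion)
  have ae': "AE x in lebesgue. g x = f x"
    using ae by (auto simp: AE_completion_iff)
  \<comment> \<open>Completeness of Lebesgue measure makes \<open>f\<close> measurable, since it
    agrees a.e. with \<open>g\<close>.\<close>
  have "integral\<^sup>L lebesgue g = integral\<^sup>L lebesgue f"
    using g' borel_measurable_AE[OF g' ae'] ae' by (rule integral_cong_AE)
  then show ?thesis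
    using integral_completion[OF g] by simp
qed

lemma in_L1_borel_representative:
  assumes "in_L1 a b f"
  obtains F where "integrable lborel F" "\<And>x. x \<notin> {a<..<b} \<Longrightarrow> F x = 0"
    "AE x in lborel. x \<in> {a<..<b} \<longrightarrow> F x = f x"
proof -
  let ?f = "\<lambda>x. indicator {a<..<b} x * f x"
  have f: "integrable lebesgue ?f"
    using assms by (simp add: in_L1_def set_integrable_def)
  then obtain F where F: "F \<in> borel_measurable lborel" "AE x in lborel. ?f x = F x"
    using completion_ex_borel_measurable_real[of ?f lborel] by auto
  have "integrable lebesgue F"
    using f measurable_completion[OF F(1)]
    by (rule Bochner_Integration.integrable_cong_AE_imp) (use F(2) in \<open>auto simp: AE_completion_iff\<close>)
  then have "integrable lborel F"
    using integrable_completion[OF F(1)] by simp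
  \<comment> \<open>Multiplying by the indicator once more makes the representative vanish at every
    outside point, not just at almost every one.\<close>
  then have "integrable lborel (\<lambda>x. indicator {a<..<b} x * F x)"
    by (rule integrable_indicator_mult) simp
  then show thesis
    by (rule that) (use F(2) in auto)
qed

lemma L1_norm_eq_lborel:
  assumes F: "F \<in> borel_measurable lborel" and ae: "AE x in lborel. x \<in> {a<..<b} \<longrightarrow> F x = f x"
  shows "L1_norm a b f = (LINT x|lborel. indicator {a<..<b} x * \<bar>F x\<bar>)"
  unfolding L1_norm_def set_lebesgue_integral_def
proof (rule integral_lebesgue_eq_lborel)
  show "(\<lambda>x. indicator {a<..<b} x * \<bar>F x\<bar>) \<in> borel_measurable lborel"
    using F by simp
qed (use ae in \<open>auto split: split_indicator\<close>)

text \<open>Reflections preserve null sets. This is what allows \<open>g (t - s)\<close> to be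
  replaced by \<open>G (t - s)\<close> for a.e. \<open>s\<close>.\<close>

lemma AE_lborel_reflect:
  fixes P :: "real \<Rightarrow> bool"
  assumes "AE x in lborel. P x"
  shows "AE s in lborel. P (t - s)"
proof -
  \<comment> \<open>A null set covering the exceptional points supplies the Borel measurable
    predicate that \<open>AE_borel_affine\<close> requires.\<close>
  obtain N where N: "N \<in> null_sets lborel" "{x. \<not> P x} \<subseteq> N"
    using assms by (auto simp: eventually_ae_filter)
  then have [measurable]: "N \<in> sets borel" by auto
  have "AE s in lborel. t + (-1) * s \<notin> N"
    using AE_not_in[OF N(1)] by (intro AE_borel_affine) auto
  then show ?thesis
  proof eventually_elim
    case (elim s)
    then show ?case using N(2) by auto
  qed
qed

text \<open>The zeros of \<open>F\<close> up to \<open>a\<close> and of \<open>G\<close> up to 0 cut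
  the whole-line integral down to \<open>a < s < t\<close>. There \<open>t < b\<close> gives
  \<open>0 < t - s < b - a\<close>, where the representatives agree a.e. with \<open>f\<close> and
  \<open>g\<close>. Equality holds at every such \<open>t\<close>, since without integrability both
  sides are 0.\<close>

lemma conv_from_eq_conv:
  assumes F: "integrable lborel F" "\<And>s. s \<le> a \<Longrightarrow> F s = 0"
      "AE s in lborel. s \<in> {a<..<b} \<longrightarrow> F s = f s"
    and G: "integrable lborel G" "\<And>u. u \<le> 0 \<Longrightarrow> G u = 0"
      "AE u in lborel. u \<in> {0<..<b - a} \<longrightarrow> G u = g u"
    and t: "t \<in> {a<..<b}"
  shows "conv_from a f g t = conv F G t"
  unfolding conv_from_def conv_def set_lebesgue_integral_def
proof (rule integral_lebesgue_eq_lborel)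
  have [measurable]: "F \<in> borel_measurable borel" "G \<in> borel_measurable borel"
    using F(1) G(1) by (auto dest: borel_measurable_integrable)
  show "(\<lambda>s. F s * G (t - s)) \<in> borel_measurable lborel"
    by measurable
  show "AE s in lborel. indicator {a<..<t} s *\<^sub>R (f s * g (t - s)) = F s * G (t - s)"
    using F(3) AE_lborel_reflect[OF G(3), of t]
  proof eventually_elim
    case (elim s)
    then show ?case
      using F(2)[of s] G(2)[of "t - s"] t by (auto split: split_indicator)
  qed
qed

section \<open>Transfer of (a) and (b) to \<open>f1\<close> and \<open>f2\<close>\<close>

theorem lemma3p1:
  fixes \<eta> T\<^sub>0 \<delta> :: real and f1 f2 :: "real \<Rightarrow> real"
  assumes "0 \<le> \<eta>" and "\<eta> < T\<^sub>0" and "0 < \<delta>"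
    and "in_L1 \<eta> (T\<^sub>0 + \<delta>) f1"
    and "in_L1 0 (T\<^sub>0 + \<delta> - \<eta>) f2"
    and "nonneg_on 0 (T\<^sub>0 + \<delta> - \<eta>) f2"
  shows "(keeps_sign \<eta> (T\<^sub>0 + \<delta>) f1 \<longrightarrow>
            L1_norm \<eta> T\<^sub>0 f1 * L1_norm 0 \<delta> f2
              \<le> L1_norm \<eta> (T\<^sub>0 + \<delta>) (conv_from \<eta> f1 f2)) \<and>
         (keeps_sign \<eta> T\<^sub>0 f1 \<longrightarrow>
            L1_norm \<eta> T\<^sub>0 f1 * L1_norm 0 \<delta> f2
              \<le> L1_norm \<eta> (T\<^sub>0 + \<delta>) (conv_from \<eta> f1 f2)
                + 2 * L1_norm T\<^sub>0 (T\<^sub>0 + \<delta>) f1 * L1_norm 0 \<delta> f2)"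
proof -
  obtain F where F: "integrable lborel F" "\<And>s. s \<notin> {\<eta><..<T\<^sub>0 + \<delta>} \<Longrightarrow> F s = 0"
    "AE s in lborel. s \<in> {\<eta><..<T\<^sub>0 + \<delta>} \<longrightarrow> F s = f1 s"
    using in_L1_borel_representative[OF assms(4)] by blast
  obtain G0 where G0: "integrable lborel G0" "\<And>u. u \<notin> {0<..<T\<^sub>0 + \<delta> - \<eta>} \<Longrightarrow> G0 u = 0"
    "AE u in lborel. u \<in> {0<..<T\<^sub>0 + \<delta> - \<eta>} \<longrightarrow> G0 u = f2 u"
    using in_L1_borel_representative[OF assms(5)] by blast
  \<comment> \<open>The absolute value makes \<open>G\<close> nonnegative everywhere; as
    \<open>f2\<close> is nonnegative a.e. on its interval, \<open>G\<close> still represents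
    it.\<close>
  define G where "G u = \<bar>G0 u\<bar>" for u
  have G: "integrable lborel G" "\<And>u. 0 \<le> G u" "\<And>u. u \<le> 0 \<Longrightarrow> G u = 0"
    using G0(1,2) by (auto simp: G_def[abs_def])
  have f2: "AE u in lborel. u \<in> {0<..<T\<^sub>0 + \<delta> - \<eta>} \<longrightarrow> 0 \<le> f2 u"
    using assms(6) by (simp add: nonneg_on_def AE_completion_iff)
  have G_f2: "AE u in lborel. u \<in> {0<..<T\<^sub>0 + \<delta> - \<eta>} \<longrightarrow> G u = f2 u"
    using G0(3) f2 by eventually_elim (auto simp: G_def)
  have [measurable]: "F \<in> borel_measurable lborel" "G \<in> borel_measurable lborel"
    using F(1) G(1) by (auto dest: borel_measurable_integrable)
  have conv_measurable: "conv F G \<in> borel_measurable lborel"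
    using integrable_conv[OF F(1) G(1), of UNIV] by (auto dest: borel_measurable_integrable)
  have conv: "L1_norm \<eta> (T\<^sub>0 + \<delta>) (conv_from \<eta> f1 f2) =
      (LINT t|lborel. indicator {\<eta><..<T\<^sub>0 + \<delta>} t * \<bar>conv F G t\<bar>)"
    using conv_from_eq_conv[OF F(1) _ F(3) G(1) G(3) G_f2] F(2)
    by (intro L1_norm_eq_lborel conv_measurable) auto
  have f1_left: "L1_norm \<eta> T\<^sub>0 f1 = (LINT s|lborel. indicator {\<eta><..<T\<^sub>0} s * \<bar>F s\<bar>)"
    and f1_right: "L1_norm T\<^sub>0 (T\<^sub>0 + \<delta>) f1 = (LINT s|lborel. indicator {T\<^sub>0<..<T\<^sub>0 + \<delta>} s * \<bar>F s\<bar>)"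
    by (intro L1_norm_eq_lborel eventually_mono[OF F(3)]; use assms(2,3) in simp)+
  \<comment> \<open>Since \<open>\<eta> < T\<^sub>0\<close>, the interval
    \<open>(0, \<delta>)\<close> lies inside the one on which \<open>G\<close> represents
    \<open>f2\<close>.\<close>
  have "AE u in lborel. u \<in> {0<..<\<delta>} \<longrightarrow> G u = f2 u"
    using G_f2 assms(2) by (elim eventually_mono) auto
  then have f2_norm: "L1_norm 0 \<delta> f2 = (LINT u|lborel. indicator {0<..<\<delta>} u * G u)"
    using L1_norm_eq_lborel[of G 0 \<delta> f2] G(2) by simp
  \<comment> \<open>\<open>F\<close> is 0 up to \<eta>, so its sign on \<open>(\<eta>, b)\<close>
    extends to all \<open>s < b\<close>. This serves (a) with
    \<open>b = T\<^sub>0 + \<delta>\<close> and (b) with \<open>b = T\<^sub>0\<close>.\<close>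
  have sign: "(AE s in lborel. s < b \<longrightarrow> 0 \<le> F s) \<or> (AE s in lborel. s < b \<longrightarrow> F s \<le> 0)"
    if "keeps_sign \<eta> b f1" "b \<le> T\<^sub>0 + \<delta>" for b
  proof -
    from that(1) consider
      "AE s in lborel. s \<in> {\<eta><..<b} \<longrightarrow> 0 \<le> f1 s" | "AE s in lborel. s \<in> {\<eta><..<b} \<longrightarrow> f1 s \<le> 0"
      by (auto simp: keeps_sign_def nonneg_on_def AE_completion_iff)
    then show ?thesis
    proof cases
      case 1
      then have "AE s in lborel. s < b \<longrightarrow> 0 \<le> F s"
        using F(3)
      proof eventually_elim
        case (elim s)
        then show ?case using F(2)[of s] that(2) by (cases "s \<le> \<eta>") auto
      qed
      then show ?thesis ..
    next
      case 2
      then have "AE s in lborel. s < b \<longrightarrow> F s \<le> 0"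
        using F(3)
      proof eventually_elim
        case (elim s)
        then show ?case using F(2)[of s] that(2) by (cases "s \<le> \<eta>") auto
      qed
      then show ?thesis ..
    qed
  qed
  show ?thesis
  proof (intro conjI impI)
    assume "keeps_sign \<eta> (T\<^sub>0 + \<delta>) f1"
    then have ae: "(AE s in lborel. s < T\<^sub>0 + \<delta> \<longrightarrow> 0 \<le> F s) \<or> (AE s in lborel. s < T\<^sub>0 + \<delta> \<longrightarrow> F s \<le> 0)"
      by (rule sign) simp
    have outside: "F s = 0" if "\<not> s < T\<^sub>0 + \<delta>" for s
      using F(2) that by simp
    \<comment> \<open>\<open>F\<close> is also 0 from \<open>T\<^sub>0 + \<delta>\<close> on, so the
      sign holds on the whole line.\<close>
    have "(s < T\<^sub>0 + \<delta> \<longrightarrow> 0 \<le> F s) = (0 \<le> F s)" "(s < T\<^sub>0 + \<delta> \<longrightarrow> F s \<le> 0) = (F s \<le> 0)" for s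
      using outside[of s] by (cases "s < T\<^sub>0 + \<delta>"; simp)+
    with ae have "(AE s in lborel. 0 \<le> F s) \<or> (AE s in lborel. F s \<le> 0)"
      by simp
    then have "\<bar>conv F G t\<bar> = conv (\<lambda>s. \<bar>F s\<bar>) G t" for t
      by (intro abs_conv_keeps_sign F(1) G)
    then show "L1_norm \<eta> T\<^sub>0 f1 * L1_norm 0 \<delta> f2 \<le> L1_norm \<eta> (T\<^sub>0 + \<delta>) (conv_from \<eta> f1 f2)"
      unfolding conv f1_left f2_norm using F(1,2) G
      by (auto intro!: reverse_convolution_nonneg)
  next
    assume "keeps_sign \<eta> T\<^sub>0 f1"
    then have ae: "(AE s in lborel. s < T\<^sub>0 \<longrightarrow> 0 \<le> F s) \<or> (AE s in lborel. s < T\<^sub>0 \<longrightarrow> F s \<le> 0)"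
      by (rule sign) (use assms(3) in simp)
    \<comment> \<open>This product is nonnegative, so the estimate with constant 1 implies the one
      with constant 2.\<close>
    have "0 \<le> L1_norm T\<^sub>0 (T\<^sub>0 + \<delta>) f1 * L1_norm 0 \<delta> f2"
      unfolding f1_right f2_norm using G(2) by (intro mult_nonneg_nonneg integral_nonneg_AE) auto
    moreover have "L1_norm \<eta> T\<^sub>0 f1 * L1_norm 0 \<delta> f2
        \<le> L1_norm \<eta> (T\<^sub>0 + \<delta>) (conv_from \<eta> f1 f2) + L1_norm T\<^sub>0 (T\<^sub>0 + \<delta>) f1 * L1_norm 0 \<delta> f2"
      unfolding conv f1_left f1_right f2_norm
      using F(1,2) ae G by (rule reverse_convolution_split)
    ultimately show "L1_norm \<eta> T\<^sub>0 f1 * L1_norm 0 \<delta> f2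
        \<le> L1_norm \<eta> (T\<^sub>0 + \<delta>) (conv_from \<eta> f1 f2)
          + 2 * L1_norm T\<^sub>0 (T\<^sub>0 + \<delta>) f1 * L1_norm 0 \<delta> f2"
      by simp
  qed
qed

end
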